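(* Fix integers $t,\ell\ge0$. Let $\boldsymbol{\alpha}=(\alpha_1,\dots,\alpha_\ell)$, $\boldsymbol{\beta}=(\beta_1,\dots,\beta_\ell)$ be indeterminates, $\mathbf{y}$ a set of indeterminates, and $(b_n(\mathbf{y}))_{n\ge0}$ polynomials with nonnegative coefficients in $\mathbf{y}$. Suppose that for all $n\ge0$ the weights $a^{(i)}_n$ ($0\le i\le\ell$) satisfy $\sum_{i=0}^{\ell}a^{(i)}_n z^i=\prod_{j=1}^{\ell}(\alpha_j z+\beta_j)$; write $a^{(i)}:=a^{(i)}_n$ (independent of $n$). Let $M=[M_{n,k}]_{n,k\ge0}$ be the weighted lattice path matrix defined in the context. Then: (i) $M$ is $(\boldsymbol{\alpha},\boldsymbol{\beta},\mathbf{y})$-totally positive, and if $t\ge1$, for each $n\ge0$ the Toeplitz matrix $[M_{n,i-j}]_{i,j\ge0}$ of the $n$th row sequence is $(\boldsymbol{\alpha},\boldsymbol{\beta},\mathbf{y})$-totally positive; (ii) if $b_n=\gamma$ for all $n\ge0$ ($\gamma$ an indeterminate), then for each $k\ge0$ the Toeplitz matrix $[M_{i-j,k}]_{i,j\ge0}$ of the $k$th column sequence $(M_{n,k})_{n\ge0}$ is $(\boldsymbol{\alpha},\boldsymbol{\beta},\gamma)$-totally positive; (iii) if $b_n=\gamma$ for all $n\ge0$ and $t\ge1$, then for integers $0\le k\le n$ and $\delta,\sigma$ with $0<\delta$ and $\max\{k,\delta\}<\sigma$, the Toeplitz matrix $[s_{i-j}]_{i,j\ge0}$ of the sequence $s_i=M_{n+\delta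 i,k+\sigma i}$ ($i\ge0$) is $(\boldsymbol{\alpha},\boldsymbol{\beta},\gamma)$-totally positive; (iv) if $b_n=\gamma$ for all $n\ge0$, then $M$ is the Riordan array $\mathcal{R}\left(\frac{1}{1-\gamma z},\frac{\sum_{i=0}^{\ell}a^{(i)}z^{t+i}}{1-\gamma z}\right)$, i.e. $M_{n,k}=[z^n]\frac{1}{1-\gamma z}\left(\frac{\sum_{i=0}^{\ell}a^{(i)}z^{t+i}}{1-\gamma z}\right)^k$ for all $n,k\ge0$; (v) if $b_n=\gamma$ for all $n\ge0$, then $$M_{n,k}=\sum_{\substack{i\ge0,\ 0\le c_1,\dots,c_\ell\le k\\ i+\sum_{j=1}^{\ell}c_j=n-tk}}\binom{k+i}{i}\gamma^i\prod_{j=1}^{\ell}\binom{k}{c_j}\alpha_j^{c_j}\beta_j^{k-c_j};$$ (vi) if $b_n=\gamma$ for all $n\ge0$, then $\sum_{n\ge0}\sum_{k\ge0}M_{n,k}q^kz^n=\frac{1}{1-\gamma z-q\sum_{i=0}^{\ell}a^{(i)}z^{t+i}}$.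
   Context: For $n,k\ge0$, $M_{n,k}$ is the sum of the weights of all lattice paths in $\mathbb{N}^2$ from $(0,0)$ to $(k,n)$ using the steps $(0,1)$ and $(1,t+i)$ for $0\le i\le\ell$, where each step $(0,1)$ starting at height $n-1$ gets weight $b_n$, each step $(1,t+i)$ starting at height $n-t-i$ gets weight $a^{(i)}_n$, and the weight of a path is the product of the weights of its steps. Entries of sequences with negative index are $0$. For a set of indeterminates $\mathbf{z}$, a matrix with entries in $\mathbb{R}[\mathbf{z}]$ is $\mathbf{z}$-totally positive if all its minors are polynomials with nonnegative coefficients in $\mathbf{z}$. For formal power series $g,f$, the Riordan array $\mathcal{R}(g(z),f(z))$ is the matrix $[R_{n,k}]_{n,k\ge0}$ with $R_{n,k}=[z^n]g(z)f(z)^k$. *)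

theory Defs
  imports
    "HOL-Library.Poly_Mapping"
    "HOL-Library.FuncSet"
    "HOL-Library.Product_Plus"
    "HOL-Computational_Algebra.Polynomial"
    "HOL-Computational_Algebra.Formal_Power_Series"
    "Jordan_Normal_Form.Determinant"
begin

section \<open>Real polynomials in arbitrarily many indeterminates\<close>

type_synonym 'v mpol = "('v \<Rightarrow>\<^sub>0 nat) \<Rightarrow>\<^sub>0 real"

definition var :: "'v \<Rightarrow> 'v mpol" where
  "var v = Poly_Mapping.single (Poly_Mapping.single v 1) 1"

definition polys_in :: "'v set \<Rightarrow> 'v mpol set" where
  "polys_in Z = {p. \<forall>m \<in> Poly_Mapping.keys p. Poly_Mapping.keys m \<subseteq> Z}"

definition nonneg_coeffs :: "'v mpol \<Rightarrow> bool" where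
  "nonneg_coeffs p \<longleftrightarrow> (\<forall>m. 0 \<le> Poly_Mapping.lookup p m)"

text \<open>The indeterminates: \<open>Alpha j\<close> and \<open>Beta j\<close> (used for \<open>1 \<le> j \<le> \<ell>\<close>), and a further
  supply \<open>Y v\<close> indexed by a type \<open>'y\<close>, from which the set \<open>\<^bold>y\<close> and \<open>\<gamma>\<close> are taken.\<close>

datatype 'y indet = Alpha nat | Beta nat | Y 'y

abbreviation \<alpha> :: "nat \<Rightarrow> 'y indet mpol" where "\<alpha> j \<equiv> var (Alpha j)"
abbreviation \<beta> :: "nat \<Rightarrow> 'y indet mpol" where "\<beta> j \<equiv> var (Beta j)"

definition alpha_beta :: "nat \<Rightarrow> 'y indet set" where
  "alpha_beta l = Alpha ` {1..l} \<union> Beta ` {1..l}"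


section \<open>Total positivity of infinite matrices, Toeplitz matrices\<close>

text \<open>The minor of order \<open>m\<close> with row indices \<open>r 0 < \<dots> < r (m - 1)\<close> and column indices
  \<open>c 0 < \<dots> < c (m - 1)\<close>.\<close>

definition minor :: "(nat \<Rightarrow> nat \<Rightarrow> 'a :: comm_ring_1) \<Rightarrow> nat \<Rightarrow> (nat \<Rightarrow> nat) \<Rightarrow> (nat \<Rightarrow> nat) \<Rightarrow> 'a" where
  "minor A m r c = Determinant.det (Matrix.mat m m (\<lambda>(i, j). A (r i) (c j)))"

definition totally_positive_in :: "'v set \<Rightarrow> (nat \<Rightarrow> nat \<Rightarrow> 'v mpol) \<Rightarrow> bool" where
  "totally_positive_in Z A \<longleftrightarrow>
     (\<forall>i j. A i j \<in> polys_in Z) \<and>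
     (\<forall>m r c. strict_mono_on {..<m} r \<longrightarrow> strict_mono_on {..<m} c \<longrightarrow> nonneg_coeffs (minor A m r c))"

definition toeplitz :: "(nat \<Rightarrow> 'a :: zero) \<Rightarrow> nat \<Rightarrow> nat \<Rightarrow> 'a" where
  "toeplitz x i j = (if j \<le> i then x (i - j) else 0)"


section \<open>Weighted lattice paths\<close>

text \<open>A path starting at the origin is encoded by the list of its steps, as displacement vectors.\<close>

definition steps :: "nat \<Rightarrow> nat \<Rightarrow> (nat \<times> nat) set" where
  "steps t l = insert (0, 1) {(1, t + i) | i. i \<le> l}"

definition lattice_paths :: "nat \<Rightarrow> nat \<Rightarrow> nat \<times> nat \<Rightarrow> (nat \<times> nat) list set" where
  "lattice_paths t l P = {p. set p \<subseteq> steps t l \<and> sum_list p = P}"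

text \<open>Weights are indexed by the height at which a step ends: \<open>h + 1\<close> resp. \<open>h + dy\<close> for a step
  starting at height \<open>h\<close>. A step \<open>(1, dy)\<close> has superscript \<open>i = dy - t\<close>. The entry \<open>b 0\<close> is never
  used.\<close>

definition step_weight ::
  "nat \<Rightarrow> (nat \<Rightarrow> nat \<Rightarrow> 'a) \<Rightarrow> (nat \<Rightarrow> 'a) \<Rightarrow> nat \<Rightarrow> nat \<times> nat \<Rightarrow> 'a" where
  "step_weight t a b h s = (if fst s = 0 then b (h + 1) else a (snd s - t) (h + snd s))"

primrec path_weight ::
  "nat \<Rightarrow> (nat \<Rightarrow> nat \<Rightarrow> 'a :: comm_semiring_1) \<Rightarrow> (nat \<Rightarrow> 'a) \<Rightarrow> nat \<Rightarrow> (nat \<times> nat) list \<Rightarrow> 'a" where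
  "path_weight t a b h [] = 1"
| "path_weight t a b h (s # p) = step_weight t a b h s * path_weight t a b (h + snd s) p"

text \<open>Here \<open>a i n\<close> is the weight \<open>a\<^sup>(\<^sup>i\<^sup>)\<close> with index \<open>n\<close>.\<close>

definition path_matrix ::
  "nat \<Rightarrow> nat \<Rightarrow> (nat \<Rightarrow> nat \<Rightarrow> 'a :: comm_semiring_1) \<Rightarrow> (nat \<Rightarrow> 'a) \<Rightarrow> nat \<Rightarrow> nat \<Rightarrow> 'a" where
  "path_matrix t l a b n k = (\<Sum>p \<in> lattice_paths t l (k, n). path_weight t a b 0 p)"

lemma finite_lattice_paths: "finite (lattice_paths t l P)"
proof -
  have fin: "finite (steps t l)" by (auto simp: steps_def)
  have len: "length p \<le> fst (sum_list p) + snd (sum_list p)" if "set p \<subseteq> steps t l" for p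
    using that by (induction p) (auto simp: steps_def)
  have "lattice_paths t l P \<subseteq> {p. set p \<subseteq> steps t l \<and> length p \<le> fst P + snd P}"
    using len by (auto simp: lattice_paths_def)
  then show ?thesis
    using finite_lists_length_le[OF fin] by (rule finite_subset)
qed


section \<open>Reciprocals and Riordan arrays\<close>

text \<open>The reciprocal in a commutative ring, needed because the library's division of formal power
  series requires field coefficients. Where the coefficient at 0 of a power series is a unit, the
  reciprocal exists; this covers all the series below.\<close>

definition recip :: "'a :: comm_monoid_mult \<Rightarrow> 'a" where
  "recip x = (THE y. x * y = 1)"

lemma recip_unique:
  assumes "x * y = (1 :: 'a :: comm_monoid_mult)" shows "recip x = y"
  unfolding recip_def
proof (rule the_equality)
  fix z assume "x * z = 1"
  then show "z = y" using assms by (metis mult.assoc mult.commute mult.right_neutral)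
qed (fact assms)

lemma fps_mult_recip:
  fixes f :: "'a :: comm_ring_1 fps"
  assumes "fps_nth f 0 * y = 1"
  shows "f * recip f = 1"
proof -
  have "f * fps_right_inverse f y = 1"
    using fps_right_inverse[OF assms] .
  then show ?thesis using recip_unique by metis
qed

definition riordan :: "'a :: comm_ring_1 fps \<Rightarrow> 'a fps \<Rightarrow> nat \<Rightarrow> nat \<Rightarrow> 'a" where
  "riordan g f n k = fps_nth (g * f ^ k) n"

end

theory Submission
  imports Defs "HOL-Computational_Algebra.Polynomial_FPS"
begin

text \<open>Column \<open>k\<close> of the path matrix is \<open>(L A)\<^sup>k L e\<^sub>0\<close>, where \<open>A\<close> multiplies by
  \<open>z\<^sup>t\<close> times the product of the \<open>\<beta> j + \<alpha> j z\<close> and \<open>L\<close> solves \<open>g n = f n + b n * g (n - 1)\<close>.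
  Both are compositions of operations that replace one column by a nonnegative combination of itself
  and its left neighbour, and such an operation keeps all minors nonnegative by linearity of the
  determinant in that column. Writing the columns as the rows of a matrix, row \<open>0\<close> is \<open>L e\<^sub>0\<close> and row
  \<open>k + 1\<close> is \<open>L A\<close> applied to row \<open>k\<close>, so total positivity follows by induction: prepend the unit row
  \<open>e\<^sub>0\<close> to the rows transformed by \<open>A\<close>, then apply \<open>L\<close>. For the Toeplitz matrices along rows and
  along rays the same induction is carried out on the positions of a family of translated paths
  together with a record of those that already ended. For constant \<open>b\<close> the operator \<open>L\<close> is
  multiplication by \<open>1 / (1 - \<gamma> z)\<close>, and the closed forms are power series computations.\<close>

section \<open>Polynomials with nonnegative coefficients\<close>

lemma nonneg_coeffs_0 [simp]: "nonneg_coeffs 0"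
  by (simp add: nonneg_coeffs_def)

lemma nonneg_coeffs_1 [simp]: "nonneg_coeffs 1"
  by (simp add: nonneg_coeffs_def lookup_one when_def)

lemma nonneg_coeffs_var [simp]: "nonneg_coeffs (var v)"
  by (simp add: nonneg_coeffs_def var_def lookup_single when_def)

lemma nonneg_coeffs_add: "nonneg_coeffs p \<Longrightarrow> nonneg_coeffs q \<Longrightarrow> nonneg_coeffs (p + q)"
  by (simp add: nonneg_coeffs_def lookup_add)

lemma Sum_any_nonneg:
  fixes f :: "'b \<Rightarrow> real"
  shows "(\<And>x. 0 \<le> f x) \<Longrightarrow> 0 \<le> Sum_any f"
  by (auto simp: Sum_any.expand_set intro: sum_nonneg)

lemma nonneg_coeffs_mult: "nonneg_coeffs p \<Longrightarrow> nonneg_coeffs q \<Longrightarrow> nonneg_coeffs (p * q)"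
  unfolding nonneg_coeffs_def lookup_mult
  by (intro allI Sum_any_nonneg mult_nonneg_nonneg) (simp_all add: when_def)

lemma polys_in_0 [simp]: "0 \<in> polys_in Z"
  by (simp add: polys_in_def)

lemma polys_in_1 [simp]: "1 \<in> polys_in Z"
  by (simp add: polys_in_def)

lemma polys_in_var: "v \<in> Z \<Longrightarrow> var v \<in> polys_in Z"
  by (simp add: polys_in_def var_def)

lemma polys_in_mono: "p \<in> polys_in Z \<Longrightarrow> Z \<subseteq> Z' \<Longrightarrow> p \<in> polys_in Z'"
  by (auto simp: polys_in_def)

lemma polys_in_add: "p \<in> polys_in Z \<Longrightarrow> q \<in> polys_in Z \<Longrightarrow> p + q \<in> polys_in Z"
  using keys_add[of p q] by (auto simp: polys_in_def)

lemma polys_in_mult: 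
  assumes "p \<in> polys_in Z" "q \<in> polys_in Z"
  shows "p * q \<in> polys_in Z"
proof -
  have "Poly_Mapping.keys m \<subseteq> Z" if m: "m \<in> Poly_Mapping.keys (p * q)" for m
  proof -
    obtain m1 m2 where "m = m1 + m2" "m1 \<in> Poly_Mapping.keys p" "m2 \<in> Poly_Mapping.keys q"
      using m keys_mult[of p q] by blast
    then show ?thesis using assms keys_add[of m1 m2] by (force simp: polys_in_def)
  qed
  then show ?thesis by (simp add: polys_in_def)
qed

lemma polys_in_sum: "(\<And>x. x \<in> A \<Longrightarrow> f x \<in> polys_in Z) \<Longrightarrow> sum f A \<in> polys_in Z"
  by (induction A rule: infinite_finite_induct) (auto intro: polys_in_add)


section \<open>Minors under column and row operations\<close>

lemma det_cong:
  assumes "\<And>i j. i < m \<Longrightarrow> j < m \<Longrightarrow> f i j = g i j"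
  shows "det (mat m m (\<lambda>(i, j). f i j)) = det (mat m m (\<lambda>(i, j). g i j))"
  using assms by (intro arg_cong[of _ _ det] eq_matI) auto

lemma minor_cong:
  assumes "\<And>i j. i < m \<Longrightarrow> j < m \<Longrightarrow> A (r i) (c j) = B (r' i) (c' j)"
  shows "minor A m r c = minor B m r' c'"
  unfolding minor_def using assms by (rule det_cong)

lemma minor_transpose: "minor A m r c = minor (\<lambda>i j. A j i) m c r"
  unfolding minor_def
  by (subst det_transpose[of _ m, symmetric]) (auto intro!: arg_cong[of _ _ det] eq_matI)

text \<open>Laplace expansion along column \<open>s\<close>: the three matrices share the cofactors
  of that column, because these delete it.\<close>

lemma det_column_linear:
  fixes f g h :: "nat \<Rightarrow> nat \<Rightarrow> 'a :: comm_ring_1"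
  assumes s: "s < m"
    and off: "\<And>i j. j \<noteq> s \<Longrightarrow> f i j = g i j" "\<And>i j. j \<noteq> s \<Longrightarrow> f i j = h i j"
    and at: "\<And>i. f i s = p * g i s + q * h i s"
  shows "det (mat m m (\<lambda>(i, j). f i j)) =
         p * det (mat m m (\<lambda>(i, j). g i j)) + q * det (mat m m (\<lambda>(i, j). h i j))"
proof -
  let ?M = "\<lambda>f. mat m m (\<lambda>(i, j). f i j) :: 'a mat"
  have cof: "cofactor (?M u) i s = cofactor (?M f) i s"
    if "\<And>i j. j \<noteq> s \<Longrightarrow> f i j = u i j" "i < m" for u i
  proof -
    have "mat_delete (?M u) i s = mat_delete (?M f) i s"
      using that s by (intro eq_matI) (auto simp: mat_delete_def)
    then show ?thesis by (simp add: cofactor_def)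
  qed
  have expand: "det (?M u) = (\<Sum>i<m. u i s * cofactor (?M f) i s)"
    if "\<And>i j. j \<noteq> s \<Longrightarrow> f i j = u i j" for u
    using s cof[OF that] by (subst laplace_expansion_column[of _ m s]) (auto intro!: sum.cong)
  have "det (?M f) = (\<Sum>i<m. f i s * cofactor (?M f) i s)"
    "det (?M g) = (\<Sum>i<m. g i s * cofactor (?M f) i s)"
    "det (?M h) = (\<Sum>i<m. h i s * cofactor (?M f) i s)"
    using off by (intro expand; simp)+
  then show ?thesis
    by (simp add: at sum_distrib_left sum.distrib[symmetric] algebra_simps)
qed

lemma minor_zero_col:
  assumes "s < m" "\<And>i. i < m \<Longrightarrow> A (r i) (c s) = 0"
  shows "minor A m r c = 0"
  unfolding minor_def using assms by (subst laplace_expansion_column[of _ m s]) auto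

lemma minor_repeated_col:
  assumes "i < j" "j < m" "c i = c j"
  shows "minor A m r c = 0"
  unfolding minor_def
  using assms by (intro det_identical_columns[of _ m i j]) (auto intro!: eq_vecI)

text \<open>Bounding the row indices allows matrices to be built up row by row.\<close>

definition nonneg_minors :: "nat \<Rightarrow> (nat \<Rightarrow> nat \<Rightarrow> 'v mpol) \<Rightarrow> bool" where
  "nonneg_minors K W \<longleftrightarrow>
     (\<forall>m r c. strict_mono_on {..<m} r \<longrightarrow> strict_mono_on {..<m} c \<longrightarrow> (\<forall>i<m. r i < K) \<longrightarrow>
        nonneg_coeffs (minor W m r c))"

lemma nonneg_minorsI:
  assumes "\<And>m r c. strict_mono_on {..<m} r \<Longrightarrow> strict_mono_on {..<m} c \<Longrightarrow> (\<And>i. i < m \<Longrightarrow> r i < K)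
    \<Longrightarrow> nonneg_coeffs (minor W m r c)"
  shows "nonneg_minors K W"
  using assms by (auto simp: nonneg_minors_def)

lemma nonneg_minorsD:
  assumes "nonneg_minors K W" "strict_mono_on {..<m} r" "strict_mono_on {..<m} c"
    "\<And>i. i < m \<Longrightarrow> r i < K"
  shows "nonneg_coeffs (minor W m r c)"
  using assms by (auto simp: nonneg_minors_def)

lemma nonneg_minors_cong:
  assumes "\<And>j i. j < K \<Longrightarrow> W j i = V j i"
  shows "nonneg_minors K W = nonneg_minors K V"
proof -
  have "minor W m r c = minor V m r c" if "\<forall>i<m. r i < K" for m r c
    using that assms by (intro minor_cong) auto
  then show ?thesis unfolding nonneg_minors_def by (metis (no_types))
qed

lemma strict_mono_on_bounded:
  fixes r :: "nat \<Rightarrow> nat"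
  obtains K where "\<And>i. i < m \<Longrightarrow> r i < K"
proof
  show "r i < Suc (sum r {..<m})" if "i < m" for i
    using member_le_sum[of i "{..<m}" r] that by auto
qed

lemma nonneg_minors_0 [simp]: "nonneg_minors 0 W"
proof (rule nonneg_minorsI)
  fix m :: nat and r c :: "nat \<Rightarrow> nat"
  assume "\<And>i. i < m \<Longrightarrow> r i < 0"
  then have "m = 0" by (metis gr0I not_less_zero)
  then show "nonneg_coeffs (minor W m r c)" by (simp add: minor_def)
qed

section \<open>Insertion of rows and columns, and elementary column operations\<close>

text \<open>A minor that meets a zero column vanishes, and any other one is a minor of
  \<open>W\<close> with columns \<open>g \<circ> c\<close>. This serves both to insert zero columns
  and to drop or shift columns.\<close>

lemma nonneg_minors_select_cols:
  assumes W: "nonneg_minors K W" and g: "strict_mono_on S g"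
  shows "nonneg_minors K (\<lambda>j i. if i \<in> S then W j (g i) else 0)"
proof (rule nonneg_minorsI)
  fix m and r c :: "nat \<Rightarrow> nat"
  assume r: "strict_mono_on {..<m} r" "\<And>i. i < m \<Longrightarrow> r i < K" and c: "strict_mono_on {..<m} c"
  let ?V = "\<lambda>j i. if i \<in> S then W j (g i) else 0"
  show "nonneg_coeffs (minor ?V m r c)"
  proof (cases "\<forall>i<m. c i \<in> S")
    case True
    then have "minor ?V m r c = minor W m r (g \<circ> c)"
      by (intro minor_cong) auto
    moreover have "strict_mono_on {..<m} (g \<circ> c)"
      using True c g by (auto simp: strict_mono_on_def)
    ultimately show ?thesis using nonneg_minorsD[OF W r(1)] r(2) by simp
  next
    case False
    then obtain s where "s < m" "c s \<notin> S" by blast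
    then have "minor ?V m r c = 0" by (intro minor_zero_col[of s]) auto
    then show ?thesis by simp
  qed
qed

text \<open>If the new row is chosen, it comes first. Expansion along it leaves at most the top left
  cofactor, whose sign is positive, because only the first chosen column can have index 0.\<close>

lemma nonneg_minors_prepend:
  assumes W: "nonneg_minors K W"
  shows "nonneg_minors (Suc K)
    (\<lambda>j i. case j of 0 \<Rightarrow> if i = 0 then 1 else 0 | Suc j' \<Rightarrow> W j' i)"
    (is "nonneg_minors _ ?V")
proof (rule nonneg_minorsI)
  fix m and r c :: "nat \<Rightarrow> nat"
  assume r: "strict_mono_on {..<m} r" and rK: "\<And>i. i < m \<Longrightarrow> r i < Suc K"
    and c: "strict_mono_on {..<m} c"
  show "nonneg_coeffs (minor ?V m r c)"
  proof (cases m)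
    case 0
    then show ?thesis by (simp add: minor_def)
  next
    case (Suc m')
    have r_pos: "0 < r i" if "0 < i" "i < m" for i
      using strict_mono_onD[OF r, of 0 i] that by auto
    have c_pos: "0 < c i" if "0 < i" "i < m" for i
      using strict_mono_onD[OF c, of 0 i] that by auto
    show ?thesis
    proof (cases "r 0 = 0")
      case False
      then have pos: "0 < r i" if "i < m" for i using r_pos[of i] that by (cases "i = 0") auto
      then have "minor ?V m r c = minor W m (\<lambda>i. r i - 1) c"
        using pos by (intro minor_cong) (auto dest: pos split: nat.split)
      moreover have "strict_mono_on {..<m} (\<lambda>i. r i - 1)"
        using r pos by (fastforce simp: strict_mono_on_def intro!: diff_less_mono Suc_leI)
      moreover have "r i - 1 < K" if "i < m" for i using pos rK that by fastforce
      ultimately show ?thesis using nonneg_minorsD[OF W _ c] by simp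
    next
      case True
      have row_Suc: "?V (r (Suc i)) x = W (r (Suc i) - 1) x" if "i < m'" for i x
        using r_pos[of "Suc i"] that Suc by (cases "r (Suc i)") auto
      let ?A = "mat m m (\<lambda>(i, j). ?V (r i) (c j))"
      have "det ?A = (\<Sum>j<m. ?A $$ (0, j) * cofactor ?A 0 j)"
        using Suc by (intro laplace_expansion_row) auto
      also have "\<dots> = (\<Sum>j\<in>{0}. ?A $$ (0, j) * cofactor ?A 0 j)"
        using Suc True by (intro sum.mono_neutral_right) (auto dest: c_pos)
      also have "\<dots> = (if c 0 = 0 then cofactor ?A 0 0 else 0)"
        using Suc True by simp
      also have "cofactor ?A 0 0 = minor W m' (\<lambda>i. r (Suc i) - 1) (\<lambda>i. c (Suc i))"
        unfolding cofactor_def minor_def using Suc row_Suc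
        by (auto intro!: arg_cong[of _ _ det] eq_matI simp: mat_delete_def)
      finally have "minor ?V m r c =
          (if c 0 = 0 then minor W m' (\<lambda>i. r (Suc i) - 1) (\<lambda>i. c (Suc i)) else 0)"
        by (simp add: minor_def)
      moreover have "strict_mono_on {..<m'} (\<lambda>i. r (Suc i) - 1)"
        using r r_pos Suc by (fastforce simp: strict_mono_on_def intro!: diff_less_mono Suc_leI)
      moreover have "strict_mono_on {..<m'} (\<lambda>i. c (Suc i))"
        using c Suc by (auto simp: strict_mono_on_def)
      moreover have "r (Suc i) - 1 < K" if "i < m'" for i
        using rK[of "Suc i"] r_pos[of "Suc i"] that Suc by linarith
      ultimately show ?thesis using nonneg_minorsD[OF W] by simp
    qed
  qed
qed

text \<open>Linearity splits the minor in two. Replacing column \<open>h\<close> by its neighbour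
  \<open>h - 1\<close> either keeps the column indices increasing or repeats a column, and then the
  second minor is 0. The condition on \<open>h\<close> guards against \<open>h - 1 = 0\<close> for
  \<open>h = 0\<close>.\<close>

lemma nonneg_minors_col_op:
  assumes W: "nonneg_minors K W" and pq: "nonneg_coeffs p" "nonneg_coeffs q" and h: "0 < h \<or> q = 0"
  shows "nonneg_minors K (\<lambda>j i. if i = h then p * W j h + q * W j (h - 1) else W j i)"
    (is "nonneg_minors _ ?V")
proof (rule nonneg_minorsI)
  fix m and r c :: "nat \<Rightarrow> nat"
  assume r: "strict_mono_on {..<m} r" "\<And>i. i < m \<Longrightarrow> r i < K" and c: "strict_mono_on {..<m} c"
  have WD: "nonneg_coeffs (minor W m r d)" if "strict_mono_on {..<m} d" for d
    using nonneg_minorsD[OF W r(1) that] r(2) by blast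
  show "nonneg_coeffs (minor ?V m r c)"
  proof (cases "h \<in> c ` {..<m}")
    case False
    then have "minor ?V m r c = minor W m r c" by (intro minor_cong) auto
    then show ?thesis using WD[OF c] by simp
  next
    case True
    then obtain s where s: "s < m" "c s = h" by auto
    have ne: "c j \<noteq> h" if "j < m" "j \<noteq> s" for j
      using strict_mono_on_imp_inj_on[OF c] s that by (auto simp: inj_on_def)
    let ?d = "c(s := h - 1)"
    have "minor ?V m r c = det (mat m m (\<lambda>(i, j).
        if j = s then p * W (r i) h + q * W (r i) (h - 1) else W (r i) (c j)))"
      unfolding minor_def using ne s by (intro det_cong) auto
    also have "\<dots> = p * minor W m r c + q * minor W m r ?d"
      unfolding minor_def using s by (intro det_column_linear[of s]) auto
    finally have eq: "minor ?V m r c = p * minor W m r c + q * minor W m r ?d" .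
    have "nonneg_coeffs (q * minor W m r ?d)"
    proof (cases "q = 0 \<or> (\<exists>j<m. j \<noteq> s \<and> c j = h - 1)")
      case True
      then have "q * minor W m r ?d = 0"
      proof
        assume "\<exists>j<m. j \<noteq> s \<and> c j = h - 1"
        then obtain j where "j < m" "j \<noteq> s" "c j = h - 1" by blast
        then have "minor W m r ?d = 0"
          using s minor_repeated_col[of j s m ?d W r] minor_repeated_col[of s j m ?d W r]
          by (cases "j < s") auto
        then show ?thesis by simp
      qed simp
      then show ?thesis by simp
    next
      case False
      with h have h: "0 < h" by blast
      have "strict_mono_on {..<m} ?d"
      proof (rule strict_mono_onI)
        fix i j assume ij: "i \<in> {..<m}" "j \<in> {..<m}" "i < j"
        then have "c i < c j" using c by (auto simp: strict_mono_on_def)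
        moreover have "c i \<noteq> h - 1" if "i \<noteq> s" using False ij(1) that by blast
        ultimately show "?d i < ?d j" using ij s h by auto
      qed
      then show ?thesis using WD pq nonneg_coeffs_mult by blast
    qed
    then show ?thesis unfolding eq using WD[OF c] pq
      by (intro nonneg_coeffs_add) (auto intro: nonneg_coeffs_mult)
  qed
qed


section \<open>Operators on sequences that preserve total positivity\<close>

text \<open>The steps modelled by \<open>F\<close> climb at least \<open>d\<close>. This allows
  replacing an input by one that agrees with it at low heights, in particular by zero.\<close>

definition delayed :: "nat \<Rightarrow> ((nat \<Rightarrow> 'a) \<Rightarrow> nat \<Rightarrow> 'a) \<Rightarrow> bool" where
  "delayed d F \<longleftrightarrow> (\<forall>f g p. (\<forall>i. i + d \<le> p \<longrightarrow> f i = g i) \<longrightarrow> F f p = F g p)"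

lemma delayedD: "delayed d F \<Longrightarrow> (\<And>i. i + d \<le> p \<Longrightarrow> f i = g i) \<Longrightarrow> F f p = F g p"
  by (auto simp: delayed_def)

lemma delayed_comp:
  assumes F: "delayed d F" and G: "delayed e G"
  shows "delayed (d + e) (F \<circ> G)"
proof -
  have "F (G f) p = F (G g) p" if fg: "\<forall>i. i + (d + e) \<le> p \<longrightarrow> f i = g i" for f g p
  proof (rule delayedD[OF F])
    fix i assume "i + d \<le> p"
    then show "G f i = G g i" by (intro delayedD[OF G]) (simp add: fg)
  qed
  then show ?thesis unfolding delayed_def comp_def by blast
qed

lemma delayed_funpow: "delayed d F \<Longrightarrow> delayed (n * d) (F ^^ n)"
proof (induction n)
  case 0
  then show ?case by (simp add: delayed_def)
next
  case (Suc n)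
  then show ?case using delayed_comp[of d F "n * d" "F ^^ n"] by (simp add: comp_def)
qed

text \<open>Columns from \<open>H\<close> on are left alone: in \<open>nonneg_minors_path_rays\<close> they hold the exits of
  paths that already ended.\<close>

definition preserves_minors :: "((nat \<Rightarrow> 'v mpol) \<Rightarrow> nat \<Rightarrow> 'v mpol) \<Rightarrow> bool" where
  "preserves_minors F \<longleftrightarrow> delayed 0 F \<and>
     (\<forall>K H W. nonneg_minors K W \<longrightarrow> nonneg_minors K (\<lambda>j p. if p < H then F (W j) p else W j p))"

lemma preserves_minors_truncated:
  "preserves_minors F \<Longrightarrow> nonneg_minors K W \<Longrightarrow>
    nonneg_minors K (\<lambda>j p. if p < H then F (W j) p else W j p)"
  by (simp add: preserves_minors_def)

text \<open>A minor meets finitely many columns, so a truncation beyond all of them does not change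
  it.\<close>

lemma preserves_minors_all:
  assumes F: "preserves_minors F" and W: "nonneg_minors K W"
  shows "nonneg_minors K (\<lambda>j. F (W j))"
proof (rule nonneg_minorsI)
  fix m and r c :: "nat \<Rightarrow> nat"
  assume rc: "strict_mono_on {..<m} r" "strict_mono_on {..<m} c" "\<And>i. i < m \<Longrightarrow> r i < K"
  obtain H where H: "\<And>i. i < m \<Longrightarrow> c i < H" using strict_mono_on_bounded by blast
  have "minor (\<lambda>j. F (W j)) m r c = minor (\<lambda>j p. if p < H then F (W j) p else W j p) m r c"
    using H by (intro minor_cong) auto
  then show "nonneg_coeffs (minor (\<lambda>j. F (W j)) m r c)"
    using nonneg_minorsD[OF preserves_minors_truncated[OF F W] rc] by simp
qed

text \<open>Truncating between the two operators is harmless: below \<open>H\<close>, the outer one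
  sees only inputs below \<open>H\<close>.\<close>

lemma preserves_minors_comp:
  assumes F: "preserves_minors F" and G: "preserves_minors G"
  shows "preserves_minors (F \<circ> G)"
proof -
  have dF: "delayed 0 F" and dG: "delayed 0 G"
    using F G by (auto simp: preserves_minors_def)
  have "nonneg_minors K (\<lambda>j p. if p < H then F (G (W j)) p else W j p)"
    if W: "nonneg_minors K W" for K H W
  proof -
    let ?V = "\<lambda>j p. if p < H then G (W j) p else W j p"
    have "nonneg_minors K (\<lambda>j p. if p < H then F (?V j) p else ?V j p)"
      using F G W by (intro preserves_minors_truncated)
    moreover have "F (?V j) p = F (G (W j)) p" if "p < H" for j p
      using that by (intro delayedD[OF dF]) auto
    ultimately show ?thesis by (simp cong: if_cong)
  qed
  then show ?thesis
    using delayed_comp[OF dF dG] by (simp add: preserves_minors_def cong: if_cong)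
qed

lemma preserves_minors_id: "preserves_minors id"
  by (simp add: preserves_minors_def delayed_def cong: if_cong)

lemma preserves_minors_funpow: "preserves_minors F \<Longrightarrow> preserves_minors (F ^^ n)"
  by (induction n) (simp_all only: funpow.simps preserves_minors_id preserves_minors_comp)

section \<open>Vertical runs and linear factors as column operations\<close>

primrec accumulate :: "(nat \<Rightarrow> 'a) \<Rightarrow> (nat \<Rightarrow> 'a) \<Rightarrow> nat \<Rightarrow> 'a :: comm_semiring_1" where
  "accumulate b f 0 = f 0"
| "accumulate b f (Suc h) = f (Suc h) + b (Suc h) * accumulate b f h"

lemma delayed_accumulate: "delayed 0 (accumulate b)"
proof -
  have "(\<forall>i\<le>p. f i = g i) \<Longrightarrow> accumulate b f p = accumulate b g p" for f g p
    by (induction p) auto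
  then show ?thesis by (simp add: delayed_def)
qed

text \<open>Columns are treated from left to right, so that column \<open>H\<close> is combined with
  a left neighbour that is already accumulated.\<close>

lemma preserves_minors_accumulate:
  assumes b: "\<And>n. nonneg_coeffs (b n)"
  shows "preserves_minors (accumulate b)"
proof -
  have "nonneg_minors K (\<lambda>j p. if p < H then accumulate b (W j) p else W j p)"
    if W: "nonneg_minors K W" for K H W
  proof (induction H)
    case 0
    then show ?case using W by simp
  next
    case (Suc H)
    let ?V = "\<lambda>j p. if p < H then accumulate b (W j) p else W j p"
    have "nonneg_minors K
        (\<lambda>j i. if i = H then 1 * ?V j H + (if H = 0 then 0 else b H) * ?V j (H - 1) else ?V j i)"
      using b by (intro nonneg_minors_col_op[OF Suc]) auto
    moreover have "(if i = H then 1 * ?V j H + (if H = 0 then 0 else b H) * ?V j (H - 1) else ?V j i) =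
        (if i < Suc H then accumulate b (W j) i else W j i)" for i j
      by (cases H) auto
    ultimately show ?case by (simp only:)
  qed
  then show ?thesis by (simp add: preserves_minors_def delayed_accumulate)
qed

definition convolve :: "'a :: comm_semiring_1 fps \<Rightarrow> (nat \<Rightarrow> 'a) \<Rightarrow> nat \<Rightarrow> 'a" where
  "convolve g f = fps_nth (g * Abs_fps f)"

lemma convolve_mult: "convolve (g * h) = convolve g \<circ> convolve h"
  by (simp add: convolve_def fun_eq_iff mult.assoc fps_nth_inverse)

lemma convolve_1: "convolve 1 = id"
  by (simp add: convolve_def fun_eq_iff)

lemma convolve_linear_factor:
  "convolve (fps_const p + fps_const q * fps_X) f i =
    p * f i + q * (if i = 0 then 0 else f (i - 1))"
  by (simp add: convolve_def distrib_right mult.assoc fps_mult_left_const_nth)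

text \<open>Here the order is from right to left, so that the left neighbour still holds its
  original value; \<open>s\<close> counts the columns already treated.\<close>

lemma preserves_minors_convolve_linear:
  assumes pq: "nonneg_coeffs p" "nonneg_coeffs q"
  shows "preserves_minors (convolve (fps_const p + fps_const q * fps_X))"
proof -
  let ?F = "convolve (fps_const p + fps_const q * fps_X)"
  have "nonneg_minors K (\<lambda>j i. if H - s \<le> i \<and> i < H then ?F (W j) i else W j i)"
    if W: "nonneg_minors K W" for K H s W
  proof (induction s)
    case 0
    then show ?case using W by (subst nonneg_minors_cong[of K _ W]) auto
  next
    case (Suc s)
    let ?V = "\<lambda>j i. if H - s \<le> i \<and> i < H then ?F (W j) i else W j i"
    show ?case
    proof (cases "s < H")
      case True
      define h where "h = H - Suc s"
      have h: "H - s = Suc h" "h < H" using True by (auto simp: h_def)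
      have "nonneg_minors K
          (\<lambda>j i. if i = h then p * ?V j h + (if h = 0 then 0 else q) * ?V j (h - 1) else ?V j i)"
        using pq by (intro nonneg_minors_col_op[OF Suc]) auto
      moreover have "(if i = h then p * ?V j h + (if h = 0 then 0 else q) * ?V j (h - 1) else ?V j i) =
          (if H - Suc s \<le> i \<and> i < H then ?F (W j) i else W j i)" for i j
        using h unfolding h_def[symmetric] by (auto simp: convolve_linear_factor)
      ultimately show ?thesis by (simp only:)
    next
      case False
      then show ?thesis using Suc by simp
    qed
  qed
  from this[where s = H and H = H for H]
  have "nonneg_minors K W \<Longrightarrow> nonneg_minors K
    (\<lambda>j i. if i < H then ?F (W j) i else W j i)" for K H W
    by simp
  moreover have "delayed 0 ?F"
    unfolding delayed_def convolve_linear_factor by simp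
  ultimately show ?thesis unfolding preserves_minors_def by blast
qed

lemma preserves_minors_convolve_mult:
  "preserves_minors (convolve g) \<Longrightarrow> preserves_minors (convolve h) \<Longrightarrow>
    preserves_minors (convolve (g * h))"
  by (simp add: convolve_mult preserves_minors_comp)

lemma preserves_minors_convolve_prod:
  "(\<And>x. x \<in> A \<Longrightarrow> preserves_minors (convolve (g x))) \<Longrightarrow> preserves_minors (convolve (prod g A))"
  by (induction A rule: infinite_finite_induct)
    (auto simp: convolve_1 preserves_minors_id intro: preserves_minors_convolve_mult)

definition column_series :: "nat \<Rightarrow> nat \<Rightarrow> 'y indet mpol fps" where
  "column_series t l = fps_X ^ t * (\<Prod>j=1..l. fps_const (\<beta> j) + fps_const (\<alpha> j) * fps_X)"

lemma preserves_minors_column_series: "preserves_minors (convolve (column_series t l))"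
proof -
  have "preserves_minors (convolve (fps_const 0 + fps_const 1 * fps_X))"
    by (intro preserves_minors_convolve_linear) auto
  then have "preserves_minors (convolve fps_X)" by simp
  then have "preserves_minors (convolve (fps_X ^ t))"
    using preserves_minors_convolve_prod[of "{..<t}" "\<lambda>_. fps_X"] by simp
  then show ?thesis unfolding column_series_def
    by (intro preserves_minors_convolve_mult preserves_minors_convolve_prod
        preserves_minors_convolve_linear) auto
qed


section \<open>Columns of the path matrix\<close>

definition unit_seq :: "nat \<Rightarrow> 'a :: zero_neq_one" where
  "unit_seq i = (if i = 0 then 1 else 0)"

definition shift_up :: "nat \<Rightarrow> (nat \<Rightarrow> 'a :: zero) \<Rightarrow> nat \<Rightarrow> 'a" where
  "shift_up d f h = (if h < d then 0 else f (h - d))"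

lemma shift_up_add [simp]: "shift_up d f (h + d) = f h"
  by (simp add: shift_up_def)

lemma shift_up_shift_down:
  assumes "\<And>h. h < d \<Longrightarrow> f h = 0"
  shows "shift_up d (\<lambda>h. f (h + d)) = f"
  using assms by (auto simp: shift_up_def fun_eq_iff)

lemma convolve_X_power: "convolve (fps_X ^ d) = shift_up d"
  by (auto simp: convolve_def shift_up_def fun_eq_iff fps_X_power_mult_nth)

lemma convolve_shift_up: "convolve g (shift_up d f) = shift_up d (convolve g f)"
proof -
  have "convolve g \<circ> convolve (fps_X ^ d) = convolve (fps_X ^ d) \<circ> convolve g"
    by (simp only: convolve_mult[symmetric] mult.commute)
  then show ?thesis by (simp add: convolve_X_power fun_eq_iff)
qed

text \<open>Translation by \<open>d\<close> commutes with vertical runs if the weights have period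
  \<open>d\<close>: for constant \<open>b\<close> this is any \<open>d\<close>, for arbitrary
  \<open>b\<close> it is \<open>d = 0\<close>.\<close>

lemma accumulate_shift_up:
  assumes "\<And>h. b (h + d) = b h"
  shows "accumulate b (shift_up d f) = shift_up d (accumulate b f)"
proof
  fix h show "accumulate b (shift_up d f) h = shift_up d (accumulate b f) h"
  proof (induction h)
    case 0
    then show ?case by (simp add: shift_up_def)
  next
    case (Suc h)
    consider "Suc h < d" | "Suc h = d" | e where "h = e + d"
      by (metis add.commute le_Suc_ex less_Suc_eq_le not_less_eq linorder_less_linear)
    then show ?case
    proof cases
      case 3
      then have "accumulate b (shift_up d f) (Suc h) = f (Suc e) + b (Suc e + d) * accumulate b f e"
        using Suc shift_up_add[of d f "Suc e"] shift_up_add[of d "accumulate b f" e] by simp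
      then show ?thesis
        using 3 shift_up_add[of d "accumulate b f" "Suc e"] assms[of "Suc e"] by simp
    \<comment> \<open>At the lowest height of the shifted sequence the accumulated value below is 0,
      so both sides equal \<open>f 0\<close>.\<close>
    next
      case 2
      then have "d = Suc h" by simp
      then show ?thesis using Suc by (simp add: shift_up_def)
    qed (use Suc in \<open>simp add: shift_up_def\<close>)
  qed
qed

lemma delayed_convolve: "delayed 0 (convolve g)"
  by (auto simp: delayed_def convolve_def fps_mult_nth intro!: sum.cong)

lemma delayed_column_series: "delayed t (convolve (column_series t l))"
proof -
  have "delayed t (convolve (fps_X ^ t) :: (nat \<Rightarrow> 'y indet mpol) \<Rightarrow> _)"
    by (auto simp: convolve_X_power delayed_def shift_up_def)
  from delayed_comp[OF this delayed_convolve]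
  show ?thesis by (simp add: column_series_def convolve_mult comp_def)
qed

definition column_step :: "nat \<Rightarrow> nat \<Rightarrow> (nat \<Rightarrow> 'y indet mpol) \<Rightarrow>
    (nat \<Rightarrow> 'y indet mpol) \<Rightarrow> nat \<Rightarrow> 'y indet mpol" where
  "column_step t l b = accumulate b \<circ> convolve (column_series t l)"

definition column :: "nat \<Rightarrow> nat \<Rightarrow> (nat \<Rightarrow> 'y indet mpol) \<Rightarrow> nat \<Rightarrow> nat \<Rightarrow> 'y indet mpol" where
  "column t l b k = (column_step t l b ^^ k) (accumulate b unit_seq)"

lemma column_Suc: "column t l b (Suc k) = accumulate b (convolve (column_series t l) (column t l b k))"
  by (simp add: column_def column_step_def)

lemma column_add: "column t l b (i + k) = (column_step t l b ^^ i) (column t l b k)"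
  by (simp add: column_def funpow_add)

lemma delayed_column_step: "delayed t (column_step t l b)"
  using delayed_comp[OF delayed_accumulate delayed_column_series] by (simp add: column_step_def)

lemma preserves_minors_column_step:
  "(\<And>n. nonneg_coeffs (b n)) \<Longrightarrow> preserves_minors (column_step t l b)"
  unfolding column_step_def
  by (intro preserves_minors_comp preserves_minors_accumulate preserves_minors_column_series)

lemma funpow_column_step_shift_up:
  assumes "\<And>h. b (h + d) = b h"
  shows "(column_step t l b ^^ n) (shift_up d f) = shift_up d ((column_step t l b ^^ n) f)"
  by (induction n) (simp_all add: column_step_def accumulate_shift_up[of b, OF assms] convolve_shift_up)

lemma convolve_zero: "convolve g (\<lambda>_. 0) = (\<lambda>_. 0)"
  by (auto simp: convolve_def fps_mult_nth)

lemma accumulate_zero: "accumulate b (\<lambda>_. 0) = (\<lambda>_. 0)"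
proof
  show "accumulate b (\<lambda>_. 0) h = 0" for h by (induction h) auto
qed

lemma funpow_column_step_zero: "(column_step t l b ^^ n) (\<lambda>_. 0) = (\<lambda>_. 0)"
  by (induction n) (simp_all add: column_step_def accumulate_zero convolve_zero)

text \<open>After \<open>k\<close> steps to the right a path has climbed at least
  \<open>t * k\<close>, so below this height the starting sequence may be replaced by zero.\<close>

lemma column_eq_0:
  assumes "h < t * k" shows "column t l b k h = 0"
proof -
  have "column t l b k h = (column_step t l b ^^ k) (\<lambda>_. 0) h"
    unfolding column_def
    by (rule delayedD[OF delayed_funpow[OF delayed_column_step]])
      (use assms in \<open>auto simp: mult.commute\<close>)
  then show ?thesis by (simp add: funpow_column_step_zero)
qed

section \<open>Total positivity of the matrix and of its Toeplitz matrices\<close>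

lemma nonneg_minors_columns:
  assumes b: "\<And>n. nonneg_coeffs (b n)"
  shows "nonneg_minors K (column t l b)"
proof (induction K)
  case (Suc K)
  \<comment> \<open>The rows before their vertical runs: the origin itself, then each earlier column
    after one more step to the right.\<close>
  let ?W = "\<lambda>j i. case j of 0 \<Rightarrow> if i = 0 then 1 else 0
    | Suc j' \<Rightarrow> convolve (column_series t l) (column t l b j') i"
  have "nonneg_minors (Suc K) ?W"
    using preserves_minors_all[OF preserves_minors_column_series Suc] by (rule nonneg_minors_prepend)
  then have "nonneg_minors (Suc K) (\<lambda>j. accumulate b (?W j))"
    by (rule preserves_minors_all[OF preserves_minors_accumulate[OF b]])
  moreover have "accumulate b (?W j) = column t l b j" for j
    by (cases j) (simp_all add: column_Suc, simp add: column_def unit_seq_def[abs_def])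
  ultimately show ?case by simp
qed simp

text \<open>The next identity matrix arises by moving the present one a column to the right and
  prepending the unit row.\<close>

lemma nonneg_minors_unit: "nonneg_minors K (\<lambda>j i. if i = j then 1 else 0 :: 'v mpol)"
proof (induction K)
  case (Suc K)
  have "nonneg_minors (Suc K) (\<lambda>j i. case j of 0 \<Rightarrow> if i = 0 then 1 else 0
      | Suc j' \<Rightarrow> if i \<in> {1..} then if i - 1 = j' then 1 else 0 else (0 :: 'v mpol))"
    by (intro nonneg_minors_prepend nonneg_minors_select_cols Suc) (auto simp: strict_mono_on_def)
  then show ?case
    by (rule nonneg_minors_cong[THEN iffD1, rotated]) (auto split: nat.split)
qed simp

text \<open>The operator producing column \<open>k\<close> is applied to every row of the identity
  matrix. By translation invariance the image of unit row \<open>j\<close> is column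
  \<open>k\<close> moved up by \<open>j\<close>, which is row \<open>j\<close> of the transposed
  Toeplitz matrix.\<close>

lemma nonneg_minors_toeplitz_column:
  fixes b :: "nat \<Rightarrow> 'y indet mpol"
  assumes b: "\<And>n. nonneg_coeffs (b n)" and const: "\<And>n. b n = b 0"
  shows "nonneg_minors K (\<lambda>j i. toeplitz (column t l b k) i j)"
proof -
  have "nonneg_minors K (\<lambda>j. (column_step t l b ^^ k \<circ> accumulate b) (\<lambda>i. if i = j then 1 else 0))"
    using b by (intro preserves_minors_all[OF _ nonneg_minors_unit] preserves_minors_comp
        preserves_minors_funpow preserves_minors_column_step preserves_minors_accumulate)
  moreover have "(column_step t l b ^^ k \<circ> accumulate b) (\<lambda>i. if i = j then 1 else 0) =
      (\<lambda>i. toeplitz (column t l b k) i j)" for j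
  proof -
    have "(\<lambda>i. if i = j then 1 else 0) = (shift_up j unit_seq :: nat \<Rightarrow> 'y indet mpol)"
      by (auto simp: shift_up_def unit_seq_def fun_eq_iff)
    moreover have "b (h + j) = b h" for h using const by metis
    ultimately have "(column_step t l b ^^ k \<circ> accumulate b) (\<lambda>i. if i = j then 1 else 0) =
        shift_up j (column t l b k)"
      by (simp only: accumulate_shift_up[of b] funpow_column_step_shift_up[of b] column_def comp_apply)
    then show ?thesis
      by (auto simp: shift_up_def toeplitz_def not_less fun_eq_iff)
  qed
  ultimately show ?thesis by (simp only:)
qed

text \<open>In the frame of the newest source, a source of age \<open>i\<close> lies at \<open>(- \<sigma> i, - \<delta> i)\<close>, so
  \<open>U i h\<close> counts the paths from there to \<open>(k, h)\<close>.\<close>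

lemma column_ray_step:
  fixes t l k \<sigma> \<delta> :: nat and b :: "nat \<Rightarrow> 'y indet mpol"
  defines "U \<equiv> \<lambda>i h. column t l b (k + \<sigma> * i) (h + \<delta> * i)"
  assumes per: "\<And>h. b (h + \<delta>) = b h" and slope: "\<delta> < t * \<sigma>" and k: "k < \<sigma>"
  shows "U (Suc i) = (column_step t l b ^^ k) (accumulate b
    (\<lambda>h. convolve (column_series t l) ((column_step t l b ^^ (\<sigma> - k - 1)) (U i)) (h + \<delta>)))"
proof -
  let ?S = "column_step t l b" and ?A = "convolve (column_series t l :: 'y indet mpol fps)"
  \<comment> \<open>\<open>g\<close> describes the paths on arrival at abscissa
    \<open>\<sigma>\<close>, before their vertical runs there. \<open>X\<close> takes
    \<open>(\<sigma>, \<delta>)\<close> as the new origin and runs on to abscissa \<open>k\<close>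
    in the new frame.\<close>
  define g where "g = ?A ((?S ^^ (\<sigma> - k - 1)) (U i))"
  define X where "X = (?S ^^ k) (accumulate b (\<lambda>h. g (h + \<delta>)))"
  have per': "b (h + \<delta> * i) = b h" for h i
  proof (induction i)
    case (Suc i)
    have "b (h + \<delta> * Suc i) = b (h + \<delta> * i + \<delta>)" by (simp add: algebra_simps)
    then show ?case using per Suc by simp
  qed simp
  have le: "\<delta> * i \<le> t * (\<sigma> * i)"
    using mult_le_mono1[OF less_imp_le[OF slope], of i] by (simp add: mult.assoc)
  then have "\<delta> * i \<le> t * (k + \<sigma> * i)"
    unfolding distrib_left by linarith
  then have col: "column t l b (k + \<sigma> * i) = shift_up (\<delta> * i) (U i)"
    unfolding U_def by (intro shift_up_shift_down[symmetric] column_eq_0) simp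
  have U0: "U i h = 0" if "h < t * k" for h
  proof -
    have "h + \<delta> * i < t * (k + \<sigma> * i)"
      using that le unfolding distrib_left by linarith
    then show ?thesis unfolding U_def by (rule column_eq_0)
  qed
  \<comment> \<open>Older paths arrive at height at least \<open>t * \<sigma>\<close>, which exceeds
    \<open>\<delta>\<close>, so lowering by \<open>\<delta>\<close> cuts nothing off.\<close>
  have g0: "g h = 0" if "h < \<delta>" for h
  proof -
    have del: "delayed (t + (\<sigma> - k - 1) * t) (?A \<circ> ?S ^^ (\<sigma> - k - 1))"
      by (intro delayed_comp delayed_column_series delayed_funpow delayed_column_step)
    have "t + (\<sigma> - k - 1) * t + t * k = t * (1 + (\<sigma> - k - 1) + k)" by (simp add: algebra_simps)
    also have "\<dots> = t * \<sigma>" using k by simp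
    finally have len: "t + (\<sigma> - k - 1) * t + t * k = t * \<sigma>" .
    have "(?A \<circ> ?S ^^ (\<sigma> - k - 1)) (U i) h = (?A \<circ> ?S ^^ (\<sigma> - k - 1)) (\<lambda>_. 0) h"
      using that slope len by (intro delayedD[OF del] U0) linarith
    then show ?thesis by (simp add: g_def funpow_column_step_zero convolve_zero)
  qed
  have "k + \<sigma> * Suc i = k + (Suc (\<sigma> - k - 1 + (k + \<sigma> * i)))" using k by simp
  then have "column t l b (k + \<sigma> * Suc i) =
      (?S ^^ k) (accumulate b (?A ((?S ^^ (\<sigma> - k - 1)) (shift_up (\<delta> * i) (U i)))))"
    by (simp only: column_add column_Suc col[symmetric])
  also have "\<dots> = shift_up (\<delta> * i) ((?S ^^ k) (accumulate b g))"
    by (simp add: g_def per' funpow_column_step_shift_up[of b] accumulate_shift_up[of b] convolve_shift_up)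
  also have "g = shift_up \<delta> (\<lambda>h. g (h + \<delta>))"
    using g0 by (rule shift_up_shift_down[symmetric])
  also have "(?S ^^ k) (accumulate b \<dots>) = shift_up \<delta> X"
    by (simp add: X_def per funpow_column_step_shift_up[of b] accumulate_shift_up[of b])
  finally have "column t l b (k + \<sigma> * Suc i) (h + \<delta> + \<delta> * i) = X h" for h
    by simp
  then show ?thesis by (simp add: U_def X_def g_def fun_eq_iff algebra_simps)
qed

text \<open>By translation invariance the Toeplitz minors count families of paths whose sources lie on one
  line and whose targets lie on a parallel one. Row \<open>j\<close> of the matrix below describes the source that
  entered \<open>j\<close> periods before the newest one: columns \<open>p < n\<close> record the height \<open>p\<close> at which its
  path runs just after a target was passed, column \<open>n + d\<close> records that the path ended in the target
  passed \<open>d\<close> periods before. The inequalities say that new sources enter below all running paths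
  and that paths end above all paths running on, so that both events are row and column insertions
  at the boundary.\<close>

lemma nonneg_minors_path_rays:
  fixes t l k n \<sigma> \<delta> :: nat and b :: "nat \<Rightarrow> 'y indet mpol"
  defines "U \<equiv> \<lambda>i h. column t l b (k + \<sigma> * i) (h + \<delta> * i)"
  assumes b: "\<And>n. nonneg_coeffs (b n)"
    and per: "\<And>h. b (h + \<delta>) = b h" and slope: "\<delta> < t * \<sigma>" and k: "k < \<sigma>"
  shows "nonneg_minors K (\<lambda>j p. if p < n then U j p else toeplitz (\<lambda>i. U i n) j (p - n))"
    (is "nonneg_minors K ?Z")
proof (induction K)
  case (Suc K)
  let ?S = "column_step t l b" and ?A = "convolve (column_series t l :: 'y indet mpol fps)"
  let ?G = "?A \<circ> ?S ^^ (\<sigma> - k - 1)" and ?F = "?S ^^ k \<circ> accumulate b"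
  \<comment> \<open>Of the \<open>\<delta> + 1\<close> inserted columns, the change of origin uses
    up \<open>\<delta>\<close>. The remaining one, at height \<open>n\<close> in the new frame,
    becomes the record of paths ending in the newest target.\<close>
  let ?N = "n + \<delta> + 1"
  (* Z1 makes room for the heights n, ..., n + \<delta>, Z2 runs all paths to the abscissa of the next
     source, Z3 takes that source as the origin, Z4 adds its row, Z5 runs to the next target. *)
  define Z1 where "Z1 j p =
    (if p \<in> {..<n} \<union> {?N..} then ?Z j (if p < n then p else p - (\<delta> + 1)) else 0)" for j p
  define Z2 where "Z2 j p = (if p < ?N then ?G (Z1 j) p else Z1 j p)" for j p
  define Z3 where "Z3 j p = (if p \<in> UNIV then Z2 j (p + \<delta>) else 0)" for j p
  define Z4 where "Z4 j p = (case j of 0 \<Rightarrow> if p = 0 then 1 else 0 | Suc j' \<Rightarrow> Z3 j' p)" for j p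
  define Z5 where "Z5 j p = (if p < n + 1 then ?F (Z4 j) p else Z4 j p)" for j p
  have S: "preserves_minors ?S" and A: "preserves_minors ?A"
    by (simp_all add: preserves_minors_column_step b preserves_minors_column_series)
  have "nonneg_minors K Z1"
    unfolding Z1_def by (rule nonneg_minors_select_cols[OF Suc]) (auto simp: strict_mono_on_def)
  then have "nonneg_minors K Z2"
    unfolding Z2_def by (intro preserves_minors_truncated preserves_minors_comp preserves_minors_funpow S A)
  then have "nonneg_minors K Z3"
    unfolding Z3_def by (rule nonneg_minors_select_cols) (auto simp: strict_mono_on_def)
  then have "nonneg_minors (Suc K) Z4"
    unfolding Z4_def by (rule nonneg_minors_prepend)
  then have "nonneg_minors (Suc K) Z5"
    unfolding Z5_def
    by (intro preserves_minors_truncated preserves_minors_comp preserves_minors_funpow S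
        preserves_minors_accumulate b)
  moreover have Z5_eq: "Z5 j p = ?Z j p" for j p
  proof (cases j)
    case 0
    have "?F (Z4 0) = U 0"
      by (simp add: Z4_def[abs_def] U_def column_def unit_seq_def[abs_def])
    then show ?thesis using 0 by (auto simp: Z5_def toeplitz_def Z4_def)
  next
    case (Suc i)
    \<comment> \<open>A recorded exit moves one column to the right while its source becomes one
      period older, so the Toeplitz difference is unchanged.\<close>
    have exits: "Z4 j p = ?Z j p" if "n < p"
      using that Suc by (auto simp: Z4_def Z3_def Z2_def Z1_def toeplitz_def)
    have "?F (Z4 j) p = U j p" if p: "p \<le> n"
    proof -
      have dF: "delayed (k * t) ?F"
        using delayed_comp[OF delayed_funpow[OF delayed_column_step] delayed_accumulate] by simp
      have dG: "delayed (t + (\<sigma> - k - 1) * t) ?G"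
        by (intro delayed_comp delayed_column_series delayed_funpow delayed_column_step)
      have "k * t + (t + (\<sigma> - k - 1) * t) = t * (1 + (\<sigma> - k - 1) + k)" by (simp add: algebra_simps)
      also have "\<dots> = t * \<sigma>" using k by simp
      finally have len: "k * t + (t + (\<sigma> - k - 1) * t) = t * \<sigma>" .
      have "Z4 j q = ?G (U i) (q + \<delta>)" if q: "q + k * t \<le> p" for q
      proof -
        \<comment> \<open>\<open>Z1\<close> has lost the heights from \<open>n\<close> on, but these
          cannot contribute: the total climb \<open>t * \<sigma>\<close> exceeds
          \<open>\<delta>\<close>, so a path now at height \<open>n\<close> or more passes above the
          next target.\<close>
        have "?G (Z1 i) (q + \<delta>) = ?G (U i) (q + \<delta>)"
        proof (rule delayedD[OF dG])
          fix r assume "r + (t + (\<sigma> - k - 1) * t) \<le> q + \<delta>"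
          then have "r < n" using p q len slope by linarith
          then show "Z1 i r = U i r" by (simp add: Z1_def)
        qed
        moreover have "q + \<delta> < ?N" using q p by linarith
        ultimately show ?thesis using Suc by (simp add: Z4_def Z3_def Z2_def)
      qed
      then have "?F (Z4 j) p = ?F (\<lambda>q. ?G (U i) (q + \<delta>)) p"
        by (intro delayedD[OF dF]) simp
      also have "\<dots> = U j p"
        using fun_cong[OF column_ray_step[where b = b and \<delta> = \<delta> and k = k, OF per slope k], of l i p]
        unfolding Suc U_def by simp
      finally show ?thesis .
    qed
    then show ?thesis using exits Suc
      by (cases p n rule: linorder_cases) (auto simp: Z5_def toeplitz_def)
  qed
  ultimately show ?case by (simp only: Z5_eq[abs_def])
qed simp

text \<open>The columns from \<open>n\<close> on of the preceding matrix are the exit records, which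
  form the Toeplitz matrix itself.\<close>

lemma nonneg_minors_toeplitz_ray:
  assumes b: "\<And>n. nonneg_coeffs (b n)"
    and per: "\<And>h. b (h + \<delta>) = b h" and slope: "\<delta> < t * \<sigma>" and k: "k < \<sigma>"
  shows "nonneg_minors K (toeplitz (\<lambda>i. column t l b (k + \<sigma> * i) (n + \<delta> * i)))"
proof -
  have "nonneg_minors K (\<lambda>j p. if p \<in> UNIV then
      (\<lambda>j p. if p < n then column t l b (k + \<sigma> * j) (p + \<delta> * j)
        else toeplitz (\<lambda>i. column t l b (k + \<sigma> * i) (n + \<delta> * i)) j (p - n)) j (n + p) else 0)"
    by (rule nonneg_minors_select_cols[OF nonneg_minors_path_rays[where b = b and \<delta> = \<delta> and k = k, OF assms]])
      (auto simp: strict_mono_on_def)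
  then show ?thesis by simp
qed

lemma totally_positive_inI:
  assumes "\<And>i j. A i j \<in> polys_in Z" "\<And>K. nonneg_minors K A"
  shows "totally_positive_in Z A"
  unfolding totally_positive_in_def
proof (intro conjI allI impI)
  fix m and r c :: "nat \<Rightarrow> nat"
  assume rc: "strict_mono_on {..<m} r" "strict_mono_on {..<m} c"
  obtain K where "\<And>i. i < m \<Longrightarrow> r i < K" using strict_mono_on_bounded by blast
  then show "nonneg_coeffs (minor A m r c)" using nonneg_minorsD[OF assms(2) rc] by blast
qed (use assms in auto)

lemma totally_positive_in_transpose:
  assumes "totally_positive_in Z (\<lambda>i j. A j i)"
  shows "totally_positive_in Z A"
  using assms minor_transpose[of A] unfolding totally_positive_in_def by metis


section \<open>Lattice paths and columns\<close>

lemma path_weight_snoc: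
  "path_weight t a b h (p @ [s]) = path_weight t a b h p * step_weight t a b (h + snd (sum_list p)) s"
  by (induction p arbitrary: h) (simp_all add: mult.assoc add.assoc)

lemma lattice_paths_snoc:
  assumes "(k, n) \<noteq> (0, 0)"
  shows "lattice_paths t l (k, n) = (\<lambda>(s, p). p @ [s]) `
    (SIGMA s : {s \<in> steps t l. fst s \<le> k \<and> snd s \<le> n}. lattice_paths t l (k - fst s, n - snd s))"
    (is "_ = ?f ` ?S")
proof (intro Set.equalityI subsetI)
  fix p assume p: "p \<in> lattice_paths t l (k, n)"
  then have "p \<noteq> []" using assms by (auto simp: lattice_paths_def zero_prod_def)
  then obtain q s where q: "p = q @ [s]" by (metis rev_exhaust)
  have "sum_list q + s = (k, n)" "set q \<subseteq> steps t l" "s \<in> steps t l"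
    using p q by (auto simp: lattice_paths_def)
  then have "(s, q) \<in> ?S"
    by (cases s; cases "sum_list q") (auto simp: lattice_paths_def)
  then show "p \<in> ?f ` ?S" using q by force
qed (auto simp: lattice_paths_def)

lemma path_matrix_0_0: "path_matrix t l a b 0 0 = 1"
proof -
  have "p = []" if "set p \<subseteq> steps t l" "sum_list p = (0, 0)" for p
    using that by (cases p) (auto simp: steps_def plus_prod_def)
  then have "lattice_paths t l (0, 0) = {[]}"
    by (auto simp: lattice_paths_def zero_prod_def)
  then show ?thesis by (simp add: path_matrix_def)
qed

text \<open>The last step is split off rather than the first: it ends at height \<open>n\<close>, so
  its weight has index \<open>n\<close> whatever the rest of the path is.\<close>

lemma path_matrix_rec:
  assumes "(k, n) \<noteq> (0, 0)"
  shows "path_matrix t l a b n k =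
    (if n = 0 then 0 else b n * path_matrix t l a b (n - 1) k) +
    (if k = 0 then 0 else
      \<Sum>i\<le>l. if t + i \<le> n then a i n * path_matrix t l a b (n - (t + i)) (k - 1) else 0)"
proof -
  let ?T = "{s \<in> steps t l. fst s \<le> k \<and> snd s \<le> n}"
  let ?w = "\<lambda>s. step_weight t a b (n - snd s) s * path_matrix t l a b (n - snd s) (k - fst s)"
  have fin: "finite (steps t l)" by (auto simp: steps_def)
  have steps: "steps t l = insert (0, 1) ((\<lambda>i. (1, t + i)) ` {..l})"
    by (auto simp: steps_def)
  have "path_matrix t l a b n k =
      (\<Sum>(s, p)\<in>(SIGMA s : ?T. lattice_paths t l (k - fst s, n - snd s)). path_weight t a b 0 (p @ [s]))"
    unfolding path_matrix_def lattice_paths_snoc[OF assms]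
    by (subst sum.reindex) (auto simp: inj_on_def case_prod_unfold)
  also have "\<dots> = (\<Sum>s\<in>?T. \<Sum>p\<in>lattice_paths t l (k - fst s, n - snd s). path_weight t a b 0 (p @ [s]))"
    using fin by (subst sum.Sigma) (auto simp: finite_lattice_paths)
  also have "\<dots> = (\<Sum>s\<in>?T. ?w s)"
    by (intro sum.cong refl)
      (auto simp: path_matrix_def path_weight_snoc sum_distrib_left mult.commute lattice_paths_def
        intro!: sum.cong)
  also have "\<dots> = (\<Sum>s\<in>steps t l. if fst s \<le> k \<and> snd s \<le> n then ?w s else 0)"
    using fin by (simp add: sum.inter_filter)
  also have "\<dots> = (if 1 \<le> n then ?w (0, 1) else 0) +
      (\<Sum>i\<le>l. if 1 \<le> k \<and> t + i \<le> n then ?w (1, t + i) else 0)"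
    unfolding steps by (subst sum.insert) (auto simp: sum.reindex inj_on_def cong: if_cong)
  also have "\<dots> = (if n = 0 then 0 else b n * path_matrix t l a b (n - 1) k) +
    (if k = 0 then 0 else
      \<Sum>i\<le>l. if t + i \<le> n then a i n * path_matrix t l a b (n - (t + i)) (k - 1) else 0)"
    by (auto simp: step_weight_def cong: if_cong)
  finally show ?thesis .
qed

lemma convolve_sum_monomials:
  "convolve (\<Sum>i\<le>l. fps_const (c i) * fps_X ^ (t + i)) f n =
    (\<Sum>i\<le>l. if t + i \<le> n then c i * f (n - (t + i)) else 0)"
  unfolding convolve_def sum_distrib_right fps_sum_nth mult.assoc
  by (intro sum.cong) (auto simp: fps_X_power_mult_nth)

text \<open>Both sides satisfy the recursion over the last step: a vertical one is the recursion of
  \<open>accumulate\<close>, the others form the convolution with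
  \<open>column_series\<close>.\<close>

lemma path_matrix_eq_column:
  assumes series: "column_series t l = (\<Sum>i\<le>l. fps_const (c i) * fps_X ^ (t + i))"
    and a: "\<And>i n. i \<le> l \<Longrightarrow> a i n = c i"
  shows "path_matrix t l a b n k = column t l b k n"
proof (induction k arbitrary: n)
  case 0
  show ?case
    by (induction n) (simp_all add: path_matrix_0_0 path_matrix_rec column_def unit_seq_def)
next
  case (Suc k)
  have series_nth: "(\<Sum>i\<le>l. if t + i \<le> n then a i n * path_matrix t l a b (n - (t + i)) k else 0) =
      convolve (column_series t l) (column t l b k) n" for n
    unfolding series convolve_sum_monomials by (intro sum.cong) (auto simp: a Suc.IH)
  show ?case
  proof (induction n)
    case 0
    then show ?case using series_nth[of 0] by (simp add: path_matrix_rec column_Suc cong: if_cong)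
  next
    case (Suc n)
    then show ?case using series_nth[of "Suc n"] by (simp add: path_matrix_rec column_Suc add.commute cong: if_cong)
  qed
qed

section \<open>Weights as coefficients of the product of linear factors\<close>

lemma weights_coeff:
  assumes "(\<Sum>i\<le>l. Polynomial.monom (c i) i) = p" "i \<le> l"
  shows "c i = coeff p i"
  using assms(2) unfolding assms(1)[symmetric] coeff_sum coeff_monom by simp

lemma column_series_eq_weights:
  assumes "(\<Sum>i\<le>l. Polynomial.monom (c i) i) = (\<Prod>j=1..l. [:\<beta> j, \<alpha> j:])"
  shows "column_series t l = (\<Sum>i\<le>l. fps_const (c i) * fps_X ^ (t + i))"
proof -
  have "fps_of_poly (\<Sum>i\<le>l. Polynomial.monom (c i) i) = fps_of_poly (\<Prod>j=1..l. [:\<beta> j, \<alpha> j:])"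
    using assms by simp
  then have eq: "(\<Sum>i\<le>l. fps_const (c i) * fps_X ^ i) = (\<Prod>j=1..l. fps_const (\<beta> j) + fps_const (\<alpha> j) * fps_X)"
    by (simp add: fps_of_poly_sum fps_of_poly_prod fps_of_poly_monom fps_of_poly_pCons)
  show ?thesis
    unfolding column_series_def eq[symmetric] by (simp add: sum_distrib_left power_add mult_ac)
qed

lemma coeff_prod_linear_polys_in:
  assumes "\<And>j. j \<in> J \<Longrightarrow> u j \<in> polys_in Z" "\<And>j. j \<in> J \<Longrightarrow> v j \<in> polys_in Z"
  shows "coeff (\<Prod>j\<in>J. [:u j, v j:]) i \<in> polys_in Z"
  using assms
proof (induction J arbitrary: i rule: infinite_finite_induct)
  case (insert j J)
  then show ?case
    by (auto simp: coeff_pCons split: nat.split intro!: polys_in_add polys_in_mult)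
qed (auto simp: coeff_1)

lemma path_matrix_polys_in:
  assumes b: "\<And>n. b n \<in> polys_in Z" and a: "\<And>i n. i \<le> l \<Longrightarrow> a i n \<in> polys_in Z"
  shows "path_matrix t l a b n k \<in> polys_in Z"
proof -
  have "path_weight t a b h p \<in> polys_in Z" if "set p \<subseteq> steps t l" for h p
    using that a b
    by (induction p arbitrary: h) (auto simp: steps_def step_weight_def intro!: polys_in_mult)
  then show ?thesis
    unfolding path_matrix_def by (intro polys_in_sum) (auto simp: lattice_paths_def)
qed


section \<open>Constant vertical weights\<close>

lemma one_minus_mult_recip:
  fixes c :: "'a :: comm_ring_1"
  shows "(1 - fps_const c * fps_X) * recip (1 - fps_const c * fps_X) = 1"
  by (rule fps_mult_recip[where y = 1]) simp

lemma eq_recip_mult: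
  fixes x y z :: "'a :: comm_monoid_mult"
  assumes "x * recip x = 1" "x * y = z"
  shows "y = recip x * z"
proof -
  have "recip x * z = (x * recip x) * y"
    unfolding assms(2)[symmetric] by (simp only: mult_ac)
  then show ?thesis by (simp add: assms(1))
qed

text \<open>For constant weight the recursion says that multiplication by \<open>1 - c z\<close>
  turns the accumulated series back into \<open>f\<close>.\<close>

lemma accumulate_const:
  fixes c :: "'a :: comm_ring_1"
  shows "accumulate (\<lambda>_. c) f = convolve (recip (1 - fps_const c * fps_X)) f"
proof -
  let ?D = "1 - fps_const c * fps_X" and ?F = "Abs_fps (accumulate (\<lambda>_. c) f)"
  have "fps_nth (?D * ?F) n = fps_nth (Abs_fps f) n" for n
    by (cases n) (simp_all add: left_diff_distrib mult.assoc)
  then have "?D * ?F = Abs_fps f" by (rule fps_ext)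
  from eq_recip_mult[OF one_minus_mult_recip this]
  have "fps_nth ?F = convolve (recip ?D) f" by (simp only: convolve_def)
  then show ?thesis by (simp add: fun_eq_iff)
qed

lemma column_const:
  fixes c :: "'y indet mpol"
  shows "column t l (\<lambda>_. c) k n =
    fps_nth (recip (1 - fps_const c * fps_X) * (column_series t l * recip (1 - fps_const c * fps_X)) ^ k) n"
proof -
  let ?R = "recip (1 - fps_const c * fps_X)" and ?A = "column_series t l"
  have "column t l (\<lambda>_. c) k = fps_nth (?R * (?A * ?R) ^ k)"
  proof (induction k)
    case 0
    have "Abs_fps unit_seq = (1 :: 'y indet mpol fps)" by (rule fps_ext) (simp add: unit_seq_def)
    then show ?case by (simp add: column_def accumulate_const convolve_def)
  next
    case (Suc k)
    show ?case
      unfolding column_Suc Suc accumulate_const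
      by (simp add: convolve_def fps_nth_inverse mult_ac)
  qed
  then show ?thesis by simp
qed

text \<open>The negative binomial series: by Pascal's rule
  \<open>(1 - c z) * B (Suc k) = B k\<close>.\<close>

lemma recip_power_nth:
  fixes c :: "'a :: comm_ring_1"
  shows "fps_nth (recip (1 - fps_const c * fps_X) ^ Suc k) i = of_nat ((k + i) choose i) * c ^ i"
proof -
  let ?D = "1 - fps_const c * fps_X" and ?R = "recip (1 - fps_const c * fps_X)"
  define B where "B k = Abs_fps (\<lambda>i. of_nat ((k + i) choose i) * c ^ i)" for k
  note cancel = eq_recip_mult[OF one_minus_mult_recip]
  have "fps_nth (?D * B 0) n = fps_nth 1 n" for n
    by (cases n) (simp_all add: B_def left_diff_distrib mult.assoc)
  then have B0: "B 0 = ?R * 1" by (intro cancel fps_ext)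
  have "fps_nth (?D * B (Suc k)) n = fps_nth (B k) n" for k n
    by (cases n) (simp_all add: B_def left_diff_distrib mult.assoc algebra_simps)
  then have "B (Suc k) = ?R * B k" for k by (intro cancel fps_ext)
  then have power: "?R ^ Suc k = B k" by (induction k) (use B0 in simp_all)
  show ?thesis unfolding power by (simp add: B_def)
qed

lemma fps_const_prod: "fps_const (prod f A) = (\<Prod>x\<in>A. fps_const (f x :: 'a :: comm_ring_1))"
  by (induction A rule: infinite_finite_induct) (simp_all flip: fps_const_mult)

lemma prod_linear_power:
  fixes u v :: "nat \<Rightarrow> 'a :: comm_ring_1"
  shows "(\<Prod>j=1..l. fps_const (v j) + fps_const (u j) * fps_X) ^ k =
    (\<Sum>e \<in> {1..l} \<rightarrow>\<^sub>E {0..k}. fps_const (\<Prod>j=1..l. of_nat (k choose e j) * u j ^ e j * v j ^ (k - e j)) *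
      fps_X ^ (\<Sum>j=1..l. e j))"
proof -
  have binom: "(fps_const (v j) + fps_const (u j) * fps_X) ^ k =
      (\<Sum>i\<in>{0..k}. fps_const (of_nat (k choose i) * u j ^ i * v j ^ (k - i)) * fps_X ^ i)" for j
    by (subst add.commute, subst binomial_ring)
      (auto simp: atLeast0AtMost power_mult_distrib fps_const_power fps_of_nat mult_ac
        simp flip: fps_const_mult intro!: sum.cong)
  show ?thesis
    unfolding prod_power_distrib binom fps_const_prod power_sum
    by (simp add: prod_sum_PiE prod.distrib)
qed

lemma column_const_explicit:
  "column t l (\<lambda>_. c) k n =
    (\<Sum>(i, e) \<in> {(i, e). e \<in> {1..l} \<rightarrow>\<^sub>E {0..k} \<and> int i + (\<Sum>j=1..l. int (e j)) = int n - int t * int k}.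
      of_nat ((k + i) choose i) * c ^ i *
      (\<Prod>j=1..l. of_nat (k choose e j) * \<alpha> j ^ e j * \<beta> j ^ (k - e j)))"
proof -
  let ?E = "{1..l} \<rightarrow>\<^sub>E {0..k}" and ?s = "\<lambda>e. \<Sum>j=1..l. e j"
  let ?R = "recip (1 - fps_const c * fps_X)"
  let ?h = "\<lambda>e. \<Prod>j=1..l. of_nat (k choose e j) * \<alpha> j ^ e j * \<beta> j ^ (k - e j)"
  let ?g = "\<lambda>i. of_nat ((k + i) choose i) * c ^ i"
  let ?E' = "{e \<in> ?E. t * k + ?s e \<le> n}"
  have fin: "finite ?E" by (intro finite_PiE) auto
  have "?R * (column_series t l * ?R) ^ k =
      fps_X ^ (t * k) * ((\<Prod>j=1..l. fps_const (\<beta> j) + fps_const (\<alpha> j) * fps_X) ^ k * ?R ^ Suc k)"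
    unfolding column_series_def power_mult by (simp add: power_mult_distrib mult_ac)
  also have "\<dots> = (\<Sum>e\<in>?E. fps_const (?h e) * (fps_X ^ (t * k + ?s e) * ?R ^ Suc k))"
    unfolding prod_linear_power sum_distrib_left sum_distrib_right
    by (intro sum.cong refl) (simp add: power_add mult_ac)
  finally have series: "?R * (column_series t l * ?R) ^ k = \<dots>" .
  have "column t l (\<lambda>_. c) k n =
      (\<Sum>e\<in>?E. if t * k + ?s e \<le> n then ?g (n - (t * k + ?s e)) * ?h e else 0)"
    unfolding column_const series fps_sum_nth fps_mult_left_const_nth fps_X_power_mult_nth recip_power_nth
    by (intro sum.cong refl) (simp add: mult.commute not_less)
  also have "\<dots> = (\<Sum>e\<in>?E'. ?g (n - (t * k + ?s e)) * ?h e)"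
    by (rule sum.inter_filter[OF fin, symmetric])
  \<comment> \<open>The exponent \<open>i\<close> is determined by the tuple \<open>e\<close>, so
    the sum over tuples becomes one over pairs.\<close>
  also have "\<dots> = (\<Sum>(i, e)\<in>(\<lambda>e. (n - (t * k + ?s e), e)) ` ?E'. ?g i * ?h e)"
    by (subst sum.reindex) (auto simp: inj_on_def)
  also have "(\<lambda>e. (n - (t * k + ?s e), e)) ` ?E' =
      {(i, e). e \<in> ?E \<and> int i + (\<Sum>j=1..l. int (e j)) = int n - int t * int k}"
  proof -
    \<comment> \<open>Over the integers \<open>n - t * k\<close> may be negative, and then the index
      set is empty; truncated subtraction would give 0 instead.\<close>
    have "int i + (\<Sum>j=1..l. int (e j)) = int n - int t * int k \<longleftrightarrow> i + ?s e + t * k = n" for i and e :: "nat \<Rightarrow> nat"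
      unfolding of_nat_sum[symmetric] of_nat_mult[symmetric] by linarith
    then show ?thesis by (auto simp: image_iff)
  qed
  finally show ?thesis .
qed

text \<open>The outer variable \<open>fps_X\<close> is \<open>z\<close> and the inner one,
  \<open>fps_const fps_X\<close>, is \<open>q\<close>. Multiplying by the denominator yields the
  recursion over the last step, and the empty path leaves the constant 1.\<close>

lemma path_matrix_bivariate:
  fixes c :: "'a :: comm_ring_1" and a :: "nat \<Rightarrow> nat \<Rightarrow> 'a" and t l :: nat
  assumes a: "\<And>i n. i \<le> l \<Longrightarrow> a i n = w i"
  defines "M \<equiv> path_matrix t l a (\<lambda>_. c)"
  shows "Abs_fps (\<lambda>n. Abs_fps (\<lambda>k. M n k)) =
    recip (1 - fps_const (fps_const c) * fps_X
      - fps_const fps_X * (\<Sum>i\<le>l. fps_const (fps_const (w i)) * fps_X ^ (t + i)))"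
    (is "?F = recip ?D")
proof -
  have "fps_nth (fps_nth (?D * ?F) n) k = fps_nth (fps_nth 1 n) k" for n k
  proof -
    let ?S = "\<Sum>i\<le>l. fps_const (fps_const (w i)) * fps_X ^ (t + i)"
    let ?v = "if n = 0 then 0 else c * M (n - 1) k"
    let ?h = "if k = 0 then 0 else \<Sum>i\<le>l. if t + i \<le> n then w i * M (n - (t + i)) (k - 1) else 0"
    have S_nth: "fps_nth (fps_nth (?S * ?F) n) j =
        (\<Sum>i\<le>l. if t + i \<le> n then w i * M (n - (t + i)) j else 0)" for j
      unfolding sum_distrib_right fps_sum_nth mult.assoc
      by (intro sum.cong) (auto simp: fps_X_power_mult_nth)
    have "fps_nth (fps_nth (fps_const (fps_const c) * fps_X * ?F) n) k = ?v"
      by (simp add: mult.assoc)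
    moreover have "fps_nth (fps_nth (fps_const fps_X * ?S * ?F) n) k = ?h"
      using S_nth[of "k - 1"] by (simp add: mult.assoc cong: if_cong)
    moreover have "fps_nth (fps_nth ?F n) k = (if n = 0 \<and> k = 0 then 1 else ?v + ?h)"
      unfolding M_def fps_nth_Abs_fps
      by (auto simp: path_matrix_0_0 path_matrix_rec a cong: if_cong intro!: sum.cong)
    ultimately show ?thesis
      unfolding left_diff_distrib fps_sub_nth mult_1_left by auto
  qed
  then have "?D * ?F = 1" by (intro fps_ext)
  then show ?thesis by (rule recip_unique[symmetric])
qed


theorem theorem1p7:
  fixes t l :: nat
    and Ys :: "'y set"
    and a :: "nat \<Rightarrow> nat \<Rightarrow> 'y indet mpol"
    and b :: "nat \<Rightarrow> 'y indet mpol"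
    and M :: "nat \<Rightarrow> nat \<Rightarrow> 'y indet mpol"
  assumes b_polys: "\<And>n. b n \<in> polys_in (Y ` Ys)"
    and b_nonneg: "\<And>n. nonneg_coeffs (b n)"
    and a_weights: "\<And>n. (\<Sum>i\<le>l. Polynomial.monom (a i n) i) = (\<Prod>j=1..l. [:\<beta> j, \<alpha> j:])"
    and M: "M = path_matrix t l a b"
  shows
    "totally_positive_in (alpha_beta l \<union> Y ` Ys) M \<and>
     (t \<ge> 1 \<longrightarrow> (\<forall>n. totally_positive_in (alpha_beta l \<union> Y ` Ys) (toeplitz (\<lambda>d. M n d)))) \<and>
     (\<forall>c \<gamma>. \<gamma> = var (Y c) \<and> (\<forall>n. b n = \<gamma>) \<longrightarrow>
       (\<forall>k. totally_positive_in (alpha_beta l \<union> {Y c}) (toeplitz (\<lambda>d. M d k))) \<and>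
       (t \<ge> 1 \<longrightarrow> (\<forall>n k \<delta> \<sigma>. k \<le> n \<and> 0 < \<delta> \<and> max k \<delta> < \<sigma> \<longrightarrow>
          totally_positive_in (alpha_beta l \<union> {Y c})
            (toeplitz (\<lambda>i. M (n + \<delta> * i) (k + \<sigma> * i))))) \<and>
       M = riordan
             (recip (1 - fps_const \<gamma> * fps_X))
             ((\<Sum>i\<le>l. fps_const (a i 0) * fps_X ^ (t + i)) * recip (1 - fps_const \<gamma> * fps_X)) \<and>
       (\<forall>n k. M n k =
         (\<Sum>(i, e) \<in> {(i, e). e \<in> {1..l} \<rightarrow>\<^sub>E {0..k} \<and>
                              int i + (\<Sum>j=1..l. int (e j)) = int n - int t * int k}.
            of_nat ((k + i) choose i) * \<gamma> ^ i *
            (\<Prod>j=1..l. of_nat (k choose e j) * \<alpha> j ^ e j * \<beta> j ^ (k - e j)))) \<and>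
       Abs_fps (\<lambda>n. Abs_fps (\<lambda>k. M n k)) =
         recip (1 - fps_const (fps_const \<gamma>) * fps_X
                  - fps_const fps_X * (\<Sum>i\<le>l. fps_const (fps_const (a i 0)) * fps_X ^ (t + i))))"
proof -
  define p where "p = (\<Prod>j=1..l. [:\<beta> j, \<alpha> j :: 'y indet mpol:])"
  let ?w = "\<lambda>i. a i 0"
  have a_coeff: "a i n = coeff p i" if "i \<le> l" for i n
    using weights_coeff[of "\<lambda>i. a i n" l p] a_weights[of n] that by (simp add: p_def)
  then have a_const: "a i n = ?w i" if "i \<le> l" for i n using that by simp
  note series = column_series_eq_weights[OF a_weights[of 0]]
  have M_column: "M n k = column t l b k n" for n k
    unfolding M by (rule path_matrix_eq_column[OF series a_const])
  \<comment> \<open>The set \<open>V\<close> is kept free, to be taken as \<open>Ys\<close> for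
    general \<open>b\<close> and as \<open>{c}\<close> for constant \<open>b\<close>.\<close>
  have M_polys: "M n k \<in> polys_in (alpha_beta l \<union> Y ` V)" if "\<And>n. b n \<in> polys_in (Y ` V)" for V n k
    unfolding M
  proof (rule path_matrix_polys_in)
    show "b n \<in> polys_in (alpha_beta l \<union> Y ` V)" for n
      using that by (rule polys_in_mono) auto
    show "a i n \<in> polys_in (alpha_beta l \<union> Y ` V)" if "i \<le> l" for i n
      unfolding a_coeff[OF that] p_def
      by (intro coeff_prod_linear_polys_in polys_in_var) (auto simp: alpha_beta_def)
  qed
  have toeplitz_polys: "toeplitz s i j \<in> polys_in Z" if "\<And>i. s i \<in> polys_in Z" for s Z i j
    using that by (simp add: toeplitz_def)
  have tp: "totally_positive_in (alpha_beta l \<union> Y ` Ys) M"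
  proof (rule totally_positive_in_transpose[OF totally_positive_inI])
    show "nonneg_minors K (\<lambda>i j. M j i)" for K
      unfolding M_column using nonneg_minors_columns[OF b_nonneg] by simp
  qed (use M_polys[OF b_polys] in blast)
  have tp_rows: "totally_positive_in (alpha_beta l \<union> Y ` Ys) (toeplitz (\<lambda>d. M n d))"
    if "t \<ge> 1" for n
  proof (rule totally_positive_inI)
    \<comment> \<open>A row is a ray with \<open>\<sigma> = 1\<close> and
      \<open>\<delta> = 0\<close>; every \<open>b\<close> has period 0, and \<open>t \<ge> 1\<close>
      gives the slope condition.\<close>
    have "nonneg_minors K (toeplitz (\<lambda>i. column t l b (0 + 1 * i) (n + 0 * i)))" for K
      using that by (intro nonneg_minors_toeplitz_ray b_nonneg) auto
    then show "nonneg_minors K (toeplitz (\<lambda>d. M n d))" for K by (simp add: M_column)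
  qed (intro toeplitz_polys M_polys b_polys)
  have const: "b = (\<lambda>_. \<gamma>)" "M n k \<in> polys_in (alpha_beta l \<union> {Y c})"
    if "\<gamma> = var (Y c) \<and> (\<forall>n. b n = \<gamma>)" for c \<gamma> n k
  proof -
    show b: "b = (\<lambda>_. \<gamma>)" using that by auto
    have "b n \<in> polys_in (Y ` {c})" for n using that by (simp add: polys_in_var)
    from M_polys[OF this] show "M n k \<in> polys_in (alpha_beta l \<union> {Y c})" by simp
  qed
  show ?thesis
  proof (intro conjI allI impI)
    fix c \<gamma> k assume \<gamma>: "\<gamma> = var (Y c) \<and> (\<forall>n. b n = \<gamma>)"
    show "totally_positive_in (alpha_beta l \<union> {Y c}) (toeplitz (\<lambda>d. M d k))"
    proof (rule totally_positive_in_transpose[OF totally_positive_inI])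
      show "nonneg_minors K (\<lambda>i j. toeplitz (\<lambda>d. M d k) j i)" for K
        unfolding M_column using nonneg_minors_toeplitz_column[of b K t l k] b_nonneg
        by (simp add: const(1)[OF \<gamma>])
    qed (intro toeplitz_polys const(2)[OF \<gamma>])
  next
    fix c \<gamma> and n k \<delta> \<sigma> :: nat
    assume \<gamma>: "\<gamma> = var (Y c) \<and> (\<forall>n. b n = \<gamma>)"
      and t: "t \<ge> 1" and bounds: "k \<le> n \<and> 0 < \<delta> \<and> max k \<delta> < \<sigma>"
    show "totally_positive_in (alpha_beta l \<union> {Y c}) (toeplitz (\<lambda>i. M (n + \<delta> * i) (k + \<sigma> * i)))"
    proof (rule totally_positive_inI)
      have "\<sigma> \<le> t * \<sigma>" using t by simp
      with bounds have "\<delta> < t * \<sigma>" "k < \<sigma>" by linarith+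
      then show "nonneg_minors K (toeplitz (\<lambda>i. M (n + \<delta> * i) (k + \<sigma> * i)))" for K
        unfolding M_column
        by (intro nonneg_minors_toeplitz_ray b_nonneg) (simp_all add: const(1)[OF \<gamma>])
    qed (intro toeplitz_polys const(2)[OF \<gamma>])
  next
    fix c \<gamma> assume \<gamma>: "\<gamma> = var (Y c) \<and> (\<forall>n. b n = \<gamma>)"
    show "M = riordan
             (recip (1 - fps_const \<gamma> * fps_X))
             ((\<Sum>i\<le>l. fps_const (a i 0) * fps_X ^ (t + i)) * recip (1 - fps_const \<gamma> * fps_X))"
      by (intro ext) (simp only: M_column const(1)[OF \<gamma>] column_const riordan_def series)
  next
    fix c \<gamma> n k assume \<gamma>: "\<gamma> = var (Y c) \<and> (\<forall>n. b n = \<gamma>)"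
    show "M n k =
         (\<Sum>(i, e) \<in> {(i, e). e \<in> {1..l} \<rightarrow>\<^sub>E {0..k} \<and>
                              int i + (\<Sum>j=1..l. int (e j)) = int n - int t * int k}.
            of_nat ((k + i) choose i) * \<gamma> ^ i *
            (\<Prod>j=1..l. of_nat (k choose e j) * \<alpha> j ^ e j * \<beta> j ^ (k - e j)))"
      unfolding M_column const(1)[OF \<gamma>] by (rule column_const_explicit)
  next
    fix c \<gamma> assume \<gamma>: "\<gamma> = var (Y c) \<and> (\<forall>n. b n = \<gamma>)"
    show "Abs_fps (\<lambda>n. Abs_fps (\<lambda>k. M n k)) =
         recip (1 - fps_const (fps_const \<gamma>) * fps_X
                  - fps_const fps_X * (\<Sum>i\<le>l. fps_const (fps_const (a i 0)) * fps_X ^ (t + i)))"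
      unfolding M const(1)[OF \<gamma>] by (rule path_matrix_bivariate[OF a_const])
  qed (use tp tp_rows in blast)+
qed

end
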